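(* Let $O\neq I$ be points of a Desargues affine plane, let $B\in\ell^{OI}$ be a fixed point with $B\neq O$, and let $\mathcal{R}_2=\{r_B(X)\mid X\in\ell^{OI}\}$, where $r_B(X)=B^{-1}\cdot X$. Then $\mathcal{R}_2$ forms a skew field with the addition and multiplication of points of $\ell^{OI}$, and $(\mathcal{R}_2,+,\cdot)$ is a sub-skew field of the skew field $(\ell^{OI},+,\cdot)$.
   Context: An affine plane consists of a nonempty set of points and a nonempty set of lines (sets of points) such that: any two distinct points $P,Q$ lie on exactly one line $\ell^{PQ}$; for every line $\ell$ and every point $P\notin\ell$ there is exactly one line through $P$ disjoint from $\ell$; and there exist three non-collinear points. Two lines are parallel if they are equal or disjoint. A Desargues affine plane is an affine plane satisfying Desargues' axiom: if $A,B,C,A',B',C'$ are points such that $\ell^{AA'},\ell^{BB'},\ell^{CC'},\ell^{AC},\ell^{A'C'}$ are pairwise distinct lines, $\ell^{AA'},\ell^{BB'},\ell^{CC'}$ are either all parallel or all pass through one common point, $\ell^{AB}\neq\ell^{A'B'}$, $\ell^{BC}\neq\ell^{B'C'}$, $\ell^{AB}\parallel\ell^{A'B'}$ and $\ell^{BC}\parallel\ell^{B'C'}$, then $\ell^{AC}\parallel\ell^{A'C'}$. Fix distinct points $O,I$. For $A,B\in\ell^{OI}$ choose an auxiliary point $B_1\notin\ell^{OI}$. Addition: let $P_1$ be the intersection of the line through $B_1$ parallel to $\ell^{OI}$ with the line through $A$ parallel to $\ell^{OB_1}$; then $A+B$ is the intersection of $\ell^{OI}$ with the line through $P_1$ parallel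 to $\ell^{BB_1}$. Multiplication: let $P_1$ be the intersection of the line through $A$ parallel to $\ell^{IB_1}$ with $\ell^{OB_1}$; then $A\cdot B$ is the intersection of $\ell^{OI}$ with the line through $P_1$ parallel to $\ell^{BB_1}$. It is known that these operations do not depend on $B_1$ and that $(\ell^{OI},+,\cdot)$ is a skew field (division ring) with zero $O$ and identity $I$; inverses are taken in this skew field. For $X,B\in\ell^{OI}$ with $B\neq O$, the ratio of the two points is the point $r_B(X)=r(X:B)=B^{-1}\cdot X\in\ell^{OI}$. *)

theory Defs
  imports "HOL-Algebra.Subrings"
begin

section \<open>Affine planes\<close>

text \<open>A line is identified with its set of points; \<open>L\<close> always denotes the set of lines.\<close>

definition parallel :: "'p set \<Rightarrow> 'p set \<Rightarrow> bool" where
  "parallel l m \<longleftrightarrow> l = m \<or> l \<inter> m = {}"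

text \<open>The next three descriptions are meaningful only where a unique such line or point exists;
  in particular \<open>line_through L P Q\<close> is used only for \<open>P \<noteq> Q\<close>.\<close>

definition line_through :: "'p set set \<Rightarrow> 'p \<Rightarrow> 'p \<Rightarrow> 'p set" where
  "line_through L P Q = (THE l. l \<in> L \<and> P \<in> l \<and> Q \<in> l)"

definition parallel_through :: "'p set set \<Rightarrow> 'p set \<Rightarrow> 'p \<Rightarrow> 'p set" where
  "parallel_through L l P = (THE m. m \<in> L \<and> P \<in> m \<and> parallel m l)"

definition intersection_point :: "'p set \<Rightarrow> 'p set \<Rightarrow> 'p" where
  "intersection_point l m = (THE P. P \<in> l \<and> P \<in> m)"

locale affine_plane =
  fixes Pts :: "'p set" and L :: "'p set set"
  assumes points_nonempty: "Pts \<noteq> {}"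
    and lines_nonempty: "L \<noteq> {}"
    and lines_sets_of_points: "l \<in> L \<Longrightarrow> l \<subseteq> Pts"
    and unique_line:
      "\<lbrakk>P \<in> Pts; Q \<in> Pts; P \<noteq> Q\<rbrakk> \<Longrightarrow> \<exists>!l. l \<in> L \<and> P \<in> l \<and> Q \<in> l"
    and unique_parallel:
      "\<lbrakk>l \<in> L; P \<in> Pts; P \<notin> l\<rbrakk> \<Longrightarrow> \<exists>!m. m \<in> L \<and> P \<in> m \<and> l \<inter> m = {}"
    and three_noncollinear:
      "\<exists>A\<in>Pts. \<exists>B\<in>Pts. \<exists>C\<in>Pts. distinct [A, B, C] \<and> \<not> (\<exists>l\<in>L. A \<in> l \<and> B \<in> l \<and> C \<in> l)"

text \<open>The inequalities between points express that all the lines named in the axiom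
  are defined.\<close>

locale desargues_affine_plane = affine_plane +
  assumes desargues:
    "\<lbrakk>A \<in> Pts; B \<in> Pts; C \<in> Pts; A' \<in> Pts; B' \<in> Pts; C' \<in> Pts;
      A \<noteq> A'; B \<noteq> B'; C \<noteq> C';
      A \<noteq> B; B \<noteq> C; A \<noteq> C; A' \<noteq> B'; B' \<noteq> C'; A' \<noteq> C';
      distinct [line_through L A A', line_through L B B', line_through L C C',
                line_through L A C, line_through L A' C'];
      (parallel (line_through L A A') (line_through L B B') \<and>
       parallel (line_through L B B') (line_through L C C') \<and>
       parallel (line_through L A A') (line_through L C C')) \<or>
      (\<exists>V\<in>Pts. V \<in> line_through L A A' \<and> V \<in> line_through L B B' \<and> V \<in> line_through L C C');
      line_through L A B \<noteq> line_through L A' B';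
      line_through L B C \<noteq> line_through L B' C';
      parallel (line_through L A B) (line_through L A' B');
      parallel (line_through L B C) (line_through L B' C')\<rbrakk>
     \<Longrightarrow> parallel (line_through L A C) (line_through L A' C')"


section \<open>Addition and multiplication of points on a line\<close>

text \<open>The origin \<open>O\<close> of the plane is written \<open>Z\<close>, since \<open>O\<close> is reserved syntax
  (relation composition).\<close>

definition add_via :: "'p set set \<Rightarrow> 'p \<Rightarrow> 'p \<Rightarrow> 'p \<Rightarrow> 'p \<Rightarrow> 'p \<Rightarrow> 'p" where
  "add_via L Z I B1 A B =
    (let l = line_through L Z I;
         P1 = intersection_point (parallel_through L l B1)
                (parallel_through L (line_through L Z B1) A)
     in intersection_point l (parallel_through L (line_through L B B1) P1))"

definition mult_via :: "'p set set \<Rightarrow> 'p \<Rightarrow> 'p \<Rightarrow> 'p \<Rightarrow> 'p \<Rightarrow> 'p \<Rightarrow> 'p" where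
  "mult_via L Z I B1 A B =
    (let l = line_through L Z I;
         P1 = intersection_point (parallel_through L (line_through L I B1) A)
                (line_through L Z B1)
     in intersection_point l (parallel_through L (line_through L B B1) P1))"

text \<open>The sum and the product are the results of the constructions for any choice of the
  auxiliary point. The definite description makes the operations well specified exactly
  when the result does not depend on that choice.\<close>

definition point_add :: "'p set \<Rightarrow> 'p set set \<Rightarrow> 'p \<Rightarrow> 'p \<Rightarrow> 'p \<Rightarrow> 'p \<Rightarrow> 'p" where
  "point_add Pts L Z I A B =
    (THE C. \<exists>B1. B1 \<in> Pts \<and> B1 \<notin> line_through L Z I \<and> C = add_via L Z I B1 A B)"

definition point_mult :: "'p set \<Rightarrow> 'p set set \<Rightarrow> 'p \<Rightarrow> 'p \<Rightarrow> 'p \<Rightarrow> 'p \<Rightarrow> 'p" where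
  "point_mult Pts L Z I A B =
    (THE C. \<exists>B1. B1 \<in> Pts \<and> B1 \<notin> line_through L Z I \<and> C = mult_via L Z I B1 A B)"

definition line_ring :: "'p set \<Rightarrow> 'p set set \<Rightarrow> 'p \<Rightarrow> 'p \<Rightarrow> 'p ring" where
  "line_ring Pts L Z I =
    \<lparr>carrier = line_through L Z I, mult = point_mult Pts L Z I, one = I,
     zero = Z, add = point_add Pts L Z I\<rparr>"

text \<open>The ratio of the points \<open>X\<close> and \<open>B\<close>, with the inverse taken in the multiplicative
  structure of the line.\<close>

definition ratio :: "'p set \<Rightarrow> 'p set set \<Rightarrow> 'p \<Rightarrow> 'p \<Rightarrow> 'p \<Rightarrow> 'p \<Rightarrow> 'p" where
  "ratio Pts L Z I B X =
    inv\<^bsub>line_ring Pts L Z I\<^esub> B \<otimes>\<^bsub>line_ring Pts L Z I\<^esub> X"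

definition ratio_set :: "'p set \<Rightarrow> 'p set set \<Rightarrow> 'p \<Rightarrow> 'p \<Rightarrow> 'p \<Rightarrow> 'p set" where
  "ratio_set Pts L Z I B = {ratio Pts L Z I B X | X. X \<in> line_through L Z I}"


section \<open>Skew fields\<close>

text \<open>These are the library's \<open>field\<close> and \<open>subfield\<close> without commutativity of multiplication.\<close>

locale skew_field = ring +
  assumes skew_field_Units: "Units R = carrier R - {\<zero>}"

locale sub_skew_field = skew_field R + subring K R for K and R (structure) +
  assumes sub_skew_field_Units: "Units (R \<lparr>carrier := K\<rparr>) = K - {\<zero>}"

end

theory Submission
  imports Defs
begin

text \<open>
  Desargues' axiom makes it possible to prescribe the image of one point under a translation, or under
  a dilatation with a given centre. With \<open>P + Q\<close> the image of \<open>Q\<close> under the translation taking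
  \<open>Z\<close> to \<open>P\<close>, and \<open>A \<cdot> P\<close> the image of \<open>P\<close> under the dilatation fixing \<open>Z\<close>
  and taking \<open>I\<close> to \<open>A\<close>, the whole plane becomes an abelian group with left scalars from the
  line, on which the geometric sum and product are the restrictions of these operations; the laws of a
  skew field are then laws of composition of maps. Finally \<open>X \<mapsto> B\<^sup>-\<^sup>1 \<cdot> X\<close> is a bijection
  of the line, so the set of ratios is the whole line.
\<close>

section \<open>Lines and parallels\<close>

lemma parallel_sym: "parallel l m \<Longrightarrow> parallel m l"
  by (auto simp: parallel_def)

lemma parallel_refl [simp]: "parallel l l"
  by (simp add: parallel_def)

lemma parallel_meet_eq: "\<lbrakk>parallel l m; P \<in> l; P \<in> m\<rbrakk> \<Longrightarrow> l = m"
  by (auto simp: parallel_def)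

context affine_plane
begin

abbreviation join :: "'p \<Rightarrow> 'p \<Rightarrow> 'p set" where
  "join P Q \<equiv> line_through L P Q"

lemma in_Pts: "\<lbrakk>l \<in> L; P \<in> l\<rbrakk> \<Longrightarrow> P \<in> Pts"
  using lines_sets_of_points by blast

lemma join_eq:
  assumes "l \<in> L" "P \<in> l" "Q \<in> l" "P \<noteq> Q"
  shows "join P Q = l"
proof -
  have "\<exists>!l. l \<in> L \<and> P \<in> l \<and> Q \<in> l"
    using assms in_Pts unique_line by blast
  then show ?thesis
    unfolding line_through_def using assms by (intro the1_equality) auto
qed

lemma
  assumes "P \<in> Pts" "Q \<in> Pts" "P \<noteq> Q"
  shows join_line: "join P Q \<in> L"
    and join_left: "P \<in> join P Q"
    and join_right: "Q \<in> join P Q"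
proof -
  obtain l where "l \<in> L" "P \<in> l" "Q \<in> l"
    using unique_line assms by blast
  then show "join P Q \<in> L" "P \<in> join P Q" "Q \<in> join P Q"
    using join_eq assms(3) by auto
qed

lemma join_commute: "join P Q = join Q P"
  unfolding line_through_def by (rule arg_cong[where f = The]) auto

lemma lines_eqI: "\<lbrakk>l \<in> L; m \<in> L; P \<in> l; P \<in> m; Q \<in> l; Q \<in> m; P \<noteq> Q\<rbrakk> \<Longrightarrow> l = m"
  using join_eq by blast

lemma points_eqI: "\<lbrakk>l \<in> L; m \<in> L; l \<noteq> m; P \<in> l; P \<in> m; Q \<in> l; Q \<in> m\<rbrakk> \<Longrightarrow> P = Q"
  using lines_eqI by blast

text \<open>If \<open>l\<close> and \<open>n\<close> were distinct and met in \<open>P\<close>, they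
  would be two parallels to \<open>m\<close> through a point off \<open>m\<close>.\<close>

lemma parallel_trans:
  assumes "parallel l m" "parallel m n" "l \<in> L" "m \<in> L" "n \<in> L"
  shows "parallel l n"
proof (rule ccontr)
  assume "\<not> parallel l n"
  then obtain P where P: "P \<in> l" "P \<in> n" "l \<noteq> n"
    by (auto simp: parallel_def)
  then have "P \<notin> m"
    using parallel_meet_eq assms(1,2) by metis
  then have "m \<inter> l = {}" "m \<inter> n = {}"
    using P assms(1,2) by (auto simp: parallel_def)
  then show False
    using unique_parallel[OF assms(4) in_Pts[OF assms(3)] \<open>P \<notin> m\<close>] P assms(3,5) by blast
qed

lemma parallel_meet_eq2:
  assumes "parallel l k" "parallel m k" "P \<in> l" "P \<in> m" "l \<in> L" "m \<in> L" "k \<in> L"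
  shows "l = m"
  using parallel_meet_eq[OF parallel_trans[OF assms(1) parallel_sym[OF assms(2)] assms(5,7,6)] assms(3,4)] .

lemma ex_parallel:
  assumes "l \<in> L" "P \<in> Pts"
  shows "\<exists>m. m \<in> L \<and> P \<in> m \<and> parallel m l"
proof (cases "P \<in> l")
  case False
  then obtain m where "m \<in> L" "P \<in> m" "l \<inter> m = {}"
    using unique_parallel assms by blast
  then show ?thesis
    by (auto simp: parallel_def)
qed (use assms in auto)

lemma parallel_through_eq:
  assumes "l \<in> L" "m \<in> L" "P \<in> m" "parallel m l"
  shows "parallel_through L l P = m"
  unfolding parallel_through_def
proof (rule the_equality)
  show "k = m" if "k \<in> L \<and> P \<in> k \<and> parallel k l" for k
    using parallel_meet_eq2[of k l m P] that assms by simp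
qed (use assms in simp)

lemma
  assumes "l \<in> L" "P \<in> Pts"
  shows parallel_through_line: "parallel_through L l P \<in> L"
    and parallel_through_mem: "P \<in> parallel_through L l P"
    and parallel_through_parallel: "parallel (parallel_through L l P) l"
proof -
  obtain m where "m \<in> L" "P \<in> m" "parallel m l"
    using ex_parallel assms by blast
  moreover from this have "parallel_through L l P = m"
    using parallel_through_eq assms by blast
  ultimately show "parallel_through L l P \<in> L" "P \<in> parallel_through L l P"
    "parallel (parallel_through L l P) l"
    by auto
qed

lemma intersection_point_eq:
  assumes "l \<in> L" "m \<in> L" "l \<noteq> m" "P \<in> l" "P \<in> m"
  shows "intersection_point l m = P"
  unfolding intersection_point_def
  using assms points_eqI by (intro the_equality) blast+

lemma ex_point_off:
  assumes "l \<in> L"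
  shows "\<exists>P\<in>Pts. P \<notin> l"
  using three_noncollinear assms by blast

end

section \<open>Dilatations\<close>

context affine_plane
begin

text \<open>Distinctness of the images is built in so that their join is a line. Nothing is
  prescribed outside \<open>Pts\<close>, so maps are compared only on points.\<close>

definition dilatation :: "('p \<Rightarrow> 'p) \<Rightarrow> bool" where
  "dilatation f \<longleftrightarrow> (\<forall>X\<in>Pts. f X \<in> Pts) \<and>
     (\<forall>X\<in>Pts. \<forall>Y\<in>Pts. X \<noteq> Y \<longrightarrow> f X \<noteq> f Y \<and> parallel (join X Y) (join (f X) (f Y)))"

lemma dilatation_Pts: "\<lbrakk>dilatation f; X \<in> Pts\<rbrakk> \<Longrightarrow> f X \<in> Pts"
  by (simp add: dilatation_def)

lemma dilatation_inj: "\<lbrakk>dilatation f; X \<in> Pts; Y \<in> Pts; f X = f Y\<rbrakk> \<Longrightarrow> X = Y"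
  by (auto simp: dilatation_def)

lemma dilatation_id: "dilatation (\<lambda>X. X)"
  by (simp add: dilatation_def)

lemma dilatation_comp:
  assumes "dilatation f" "dilatation g"
  shows "dilatation (\<lambda>X. f (g X))"
  unfolding dilatation_def
proof (intro conjI ballI impI)
  fix X Y assume "X \<in> Pts" "Y \<in> Pts" "X \<noteq> Y"
  then have *: "g X \<in> Pts" "g Y \<in> Pts" "g X \<noteq> g Y" "f (g X) \<in> Pts" "f (g Y) \<in> Pts" "f (g X) \<noteq> f (g Y)"
    and "parallel (join X Y) (join (g X) (g Y))"
        "parallel (join (g X) (g Y)) (join (f (g X)) (f (g Y)))"
    using assms by (auto simp: dilatation_def)
  then show "parallel (join X Y) (join (f (g X)) (f (g Y)))"
    using parallel_trans join_line \<open>X \<in> Pts\<close> \<open>Y \<in> Pts\<close> \<open>X \<noteq> Y\<close> by blast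
  show "f (g X) \<noteq> f (g Y)"
    by fact
qed (use assms in \<open>auto simp: dilatation_def\<close>)

text \<open>One known image point fixes the parallel line that carries the image of
  \<open>l\<close>. Later proofs locate unknown image points by intersecting two such lines.\<close>

lemma dilatation_mem:
  assumes f: "dilatation f" and "l \<in> L" "m \<in> L" "parallel m l" "X \<in> l" "f X \<in> m" "Y \<in> l"
  shows "f Y \<in> m"
proof (cases "X = Y")
  case False
  have pts: "X \<in> Pts" "Y \<in> Pts"
    using assms in_Pts by blast+
  then have "join X Y = l" "f X \<noteq> f Y" "parallel l (join (f X) (f Y))" "f X \<in> Pts" "f Y \<in> Pts"
    using f assms(2,5,7) False join_eq[of l X Y] by (auto simp: dilatation_def)
  then have "join (f X) (f Y) = m"
    using parallel_meet_eq2[OF parallel_sym assms(4)] join_left join_line assms(2,3,6) by blast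
  then show ?thesis
    using join_right \<open>f X \<in> Pts\<close> \<open>f Y \<in> Pts\<close> \<open>f X \<noteq> f Y\<close> by blast
qed (use assms in auto)

text \<open>Off the line \<open>X Y\<close>, the image of \<open>P\<close> is the intersection of
  the parallels to \<open>X P\<close> and \<open>Y P\<close> through the images of \<open>X\<close>
  and \<open>Y\<close>. For \<open>P\<close> on that line, a point \<open>Q\<close> off it first
  takes the place of \<open>Y\<close>.\<close>

lemma dilatation_eq:
  assumes f: "dilatation f" and g: "dilatation g" and X: "X \<in> Pts" and Y: "Y \<in> Pts"
    and "X \<noteq> Y" "f X = g X" "f Y = g Y" "P \<in> Pts"
  shows "f P = g P"
proof -
  have off: "f P = g P"
    if h: "X \<in> Pts" "Y \<in> Pts" "P \<in> Pts" "X \<noteq> Y" "f X = g X" "f Y = g Y" "P \<notin> join X Y" for X Y P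
  proof -
    have ne: "P \<noteq> X" "P \<noteq> Y"
      using h join_left join_right by auto
    define a b where "a = join X P" and "b = join Y P"
    have ab: "a \<in> L" "b \<in> L" "X \<in> a" "P \<in> a" "Y \<in> b" "P \<in> b"
      unfolding a_def b_def using h ne join_line join_left join_right by auto
    have "a \<noteq> b"
      using ab h join_eq by blast
    obtain a' where a': "a' \<in> L" "f X \<in> a'" "parallel a' a"
      using ex_parallel[OF ab(1) dilatation_Pts[OF f h(1)]] by blast
    obtain b' where b': "b' \<in> L" "f Y \<in> b'" "parallel b' b"
      using ex_parallel[OF ab(2) dilatation_Pts[OF f h(2)]] by blast
    have "a' \<noteq> b'"
      using \<open>a \<noteq> b\<close> parallel_meet_eq2[OF parallel_sym[OF a'(3)] _ ab(4,6)] a' b' ab parallel_sym by blast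
    moreover have "f P \<in> a'" "g P \<in> a'" "f P \<in> b'" "g P \<in> b'"
      using dilatation_mem[OF f ab(1) a'(1,3) ab(3) a'(2) ab(4)]
        dilatation_mem[OF g ab(1) a'(1,3) ab(3) _ ab(4)]
        dilatation_mem[OF f ab(2) b'(1,3) ab(5) b'(2) ab(6)]
        dilatation_mem[OF g ab(2) b'(1,3) ab(5) _ ab(6)] a'(2) b'(2) h(5,6) by auto
    ultimately show ?thesis
      using points_eqI a'(1) b'(1) by blast
  qed
  show ?thesis
  proof (cases "P \<in> join X Y \<and> P \<noteq> X")
    case True
    obtain Q where Q: "Q \<in> Pts" "Q \<notin> join X Y"
      using ex_point_off join_line assms by blast
    then have "f Q = g Q" "Q \<noteq> X"
      using off[OF X Y Q(1) assms(5-7) Q(2)] join_left[OF X Y assms(5)] by auto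
    moreover have "P \<notin> join X Q"
      using True Q lines_eqI[of "join X Y" "join X Q" P X] join_line join_left join_right X Y
        \<open>X \<noteq> Y\<close> \<open>Q \<noteq> X\<close> by metis
    ultimately show ?thesis
      using off[of X Q P] Q assms by auto
  qed (use off[OF X Y assms(8,5-7)] assms(6) in auto)
qed

section \<open>Translations, with the identity included\<close>

definition translation :: "('p \<Rightarrow> 'p) \<Rightarrow> bool" where
  "translation f \<longleftrightarrow> dilatation f \<and> ((\<exists>X\<in>Pts. f X = X) \<longrightarrow> (\<forall>X\<in>Pts. f X = X))"

lemma translation_dilatation: "translation f \<Longrightarrow> dilatation f"
  by (simp add: translation_def)

lemma translation_Pts: "\<lbrakk>translation f; X \<in> Pts\<rbrakk> \<Longrightarrow> f X \<in> Pts"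
  by (simp add: translation_def dilatation_def)

lemma translation_fixed: "\<lbrakk>translation f; X \<in> Pts; f X = X; Y \<in> Pts\<rbrakk> \<Longrightarrow> f Y = Y"
  by (auto simp: translation_def)

lemma translation_id: "translation (\<lambda>X. X)"
  by (simp add: translation_def dilatation_id)

text \<open>If two traces met, their common point would lie on the image of either one, hence be fixed.\<close>

lemma translation_trace:
  assumes f: "translation f" and l: "l \<in> L" "X \<in> l" "f X \<in> l"
    and m: "m \<in> L" "parallel m l" "Y \<in> m"
  shows "f Y \<in> m"
proof (cases "f Y = Y")
  case False
  have pts: "X \<in> Pts" "Y \<in> Pts" "f Y \<in> Pts"
    using l m in_Pts translation_Pts[OF f] by blast+
  have noX: "f W \<noteq> W" if "W \<in> Pts" for W
    using False translation_fixed[OF f that] pts by blast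
  define n where "n = join Y (f Y)"
  have n: "n \<in> L" "Y \<in> n" "f Y \<in> n"
    unfolding n_def using pts False join_line join_left join_right by auto
  have "parallel n l"
  proof (rule ccontr)
    assume "\<not> parallel n l"
    then obtain W where W: "W \<in> n" "W \<in> l" "n \<noteq> l"
      by (auto simp: parallel_def)
    have "f W \<in> n" "f W \<in> l"
      using dilatation_mem[OF translation_dilatation[OF f]] n l W parallel_refl by blast+
    then show False
      using points_eqI[of n l W "f W"] n l W noX in_Pts by metis
  qed
  then have "n = m"
    using parallel_meet_eq2 m n l by blast
  then show ?thesis
    using n by simp
qed (use m in auto)

text \<open>For \<open>Q\<close> off the trace \<open>l\<close> of \<open>X\<close>, the image of
  \<open>Q\<close> is the intersection of the parallel to \<open>l\<close> through \<open>Q\<close>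
  and the parallel to \<open>X Q\<close> through the image of \<open>X\<close>. So a second value
  agrees, and \<open>dilatation_eq\<close> applies.\<close>

lemma translation_eq:
  assumes f: "translation f" and g: "translation g" and X: "X \<in> Pts" and "f X = g X" "P \<in> Pts"
  shows "f P = g P"
proof (cases "f X = X")
  case True
  then show ?thesis
    using assms translation_fixed by metis
next
  case False
  define l where "l = join X (f X)"
  have l: "l \<in> L" "X \<in> l" "f X \<in> l"
    unfolding l_def using X False translation_Pts[OF f] join_line join_left join_right by auto
  obtain Q where Q: "Q \<in> Pts" "Q \<notin> l"
    using ex_point_off l by blast
  then have ne: "X \<noteq> Q"
    using l by auto
  obtain a where a: "a \<in> L" "Q \<in> a" "parallel a l"
    using ex_parallel l(1) Q by blast
  define k where "k = join X Q"
  have k: "k \<in> L" "X \<in> k" "Q \<in> k"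
    unfolding k_def using X Q ne join_line join_left join_right by auto
  obtain b where b: "b \<in> L" "f X \<in> b" "parallel b k"
    using ex_parallel k(1) translation_Pts[OF f X] by blast
  have "a \<noteq> b"
    using a b k l Q parallel_meet_eq2 parallel_sym by metis
  moreover have "f Q \<in> a" "g Q \<in> a"
    using translation_trace[OF f l a(1,3,2)] translation_trace[OF g l(1,2) _ a(1,3,2)]
      l(3) assms(4) by auto
  moreover have "f Q \<in> b" "g Q \<in> b"
    using dilatation_mem[OF translation_dilatation[OF f] k(1) b(1,3) k(2) _ k(3)]
      dilatation_mem[OF translation_dilatation[OF g] k(1) b(1,3) k(2) _ k(3)] b(2) assms(4) by auto
  ultimately have "f Q = g Q"
    using points_eqI a b by blast
  then show ?thesis
    using dilatation_eq[of f g X Q P] assms translation_dilatation Q ne by blast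
qed

text \<open>Only the condition on fixed points needs work. If the composite fixes \<open>X\<close>
  while \<open>f\<close> moves it, then a point \<open>Q\<close> off the trace stays both on its
  parallel to the trace and on the line \<open>X Q\<close>, so it is a second fixed point.\<close>

lemma translation_comp:
  assumes f: "translation f" and g: "translation g"
  shows "translation (\<lambda>X. g (f X))"
proof -
  have d: "dilatation (\<lambda>X. g (f X))"
    using f g dilatation_comp translation_dilatation by blast
  have "g (f Y) = Y" if X: "X \<in> Pts" "g (f X) = X" and Y: "Y \<in> Pts" for X Y
  proof (cases "f X = X")
    case True
    then show ?thesis
      using that translation_fixed f g by metis
  next
    case False
    define l where "l = join X (f X)"
    have l: "l \<in> L" "X \<in> l" "f X \<in> l"
      unfolding l_def using X False translation_Pts[OF f] join_line join_left join_right by auto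
    obtain Q where Q: "Q \<in> Pts" "Q \<notin> l"
      using ex_point_off l by blast
    then have ne: "X \<noteq> Q"
      using l by auto
    obtain a where a: "a \<in> L" "Q \<in> a" "parallel a l"
      using ex_parallel l(1) Q by blast
    define k where "k = join X Q"
    have k: "k \<in> L" "X \<in> k" "Q \<in> k"
      unfolding k_def using X Q ne join_line join_left join_right by auto
    have "f Q \<in> a"
      using translation_trace[OF f l a(1,3,2)] .
    \<comment> \<open>Since \<open>g\<close> takes \<open>f X\<close> back to \<open>X\<close>, the
      line \<open>l\<close> is a trace of \<open>g\<close> as well.\<close>
    then have "g (f Q) \<in> a"
      using translation_trace[OF g l(1) l(3) _ a(1,3)] X l by simp
    moreover have "g (f Q) \<in> k"
      using dilatation_mem[OF d k(1) k(1) parallel_refl k(2) _ k(3)] X k(2) by simp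
    moreover have "a \<noteq> k"
      using a k l Q parallel_meet_eq by metis
    ultimately have "g (f Q) = Q"
      using points_eqI a k by blast
    then show ?thesis
      using dilatation_eq[OF d dilatation_id X(1) Q(1) ne] X Y by simp
  qed
  then show ?thesis
    using d unfolding translation_def by blast
qed

text \<open>Both composites send \<open>X\<close> to the fourth vertex of the parallelogram on
  \<open>X\<close>, \<open>f X\<close> and \<open>g X\<close>, and a translation is determined by
  one value.\<close>

lemma translations_commute_off:
  assumes f: "translation f" and g: "translation g" and l: "l \<in> L" "X \<in> l" "f X \<in> l"
    and off: "g X \<notin> l" and P: "P \<in> Pts"
  shows "f (g P) = g (f P)"
proof -
  have X: "X \<in> Pts" "g X \<in> Pts" "f X \<in> Pts" "X \<noteq> g X"
    using l off in_Pts translation_Pts[OF g] by auto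
  define k where "k = join X (g X)"
  have k: "k \<in> L" "X \<in> k" "g X \<in> k"
    unfolding k_def using X join_line join_left join_right by auto
  obtain a where a: "a \<in> L" "g X \<in> a" "parallel a l"
    using ex_parallel l(1) X by blast
  obtain b where b: "b \<in> L" "f X \<in> b" "parallel b k"
    using ex_parallel k(1) X by blast
  have "k \<noteq> l"
    using off k by auto
  then have "a \<noteq> b"
    using parallel_meet_eq2[OF parallel_sym[OF a(3)] _ l(2) k(2)] a b k l parallel_sym by blast
  moreover have "f (g X) \<in> a" "g (f X) \<in> a"
    using translation_trace[OF f l a(1,3,2)]
      dilatation_mem[OF translation_dilatation[OF g] l(1) a(1,3) l(2) a(2) l(3)] by auto
  moreover have "g (f X) \<in> b" "f (g X) \<in> b"
    using translation_trace[OF g k b(1,3,2)]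
      dilatation_mem[OF translation_dilatation[OF f] k(1) b(1,3) k(2) b(2) k(3)] by auto
  ultimately have "f (g X) = g (f X)"
    using points_eqI a b by blast
  then show ?thesis
    using translation_eq[OF translation_comp[OF g f] translation_comp[OF f g] X(1) _ P] by simp
qed

end

section \<open>Pencils\<close>

text \<open>\<open>\<pi> P\<close> is the line through \<open>P\<close> of a class of parallels, or of the lines through
  a centre \<open>V\<close>; in the latter case \<open>V\<close> is excluded from \<open>S\<close>. Treating both at once lets
  one argument produce the translations and the central dilatations.\<close>

locale pencil = desargues_affine_plane Pts L for Pts :: "'p set" and L +
  fixes S :: "'p set" and \<pi> :: "'p \<Rightarrow> 'p set"
  assumes pencil_line: "P \<in> S \<Longrightarrow> \<pi> P \<in> L"
    and pencil_mem: "P \<in> S \<Longrightarrow> P \<in> \<pi> P"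
    and pencil_eq: "\<lbrakk>P \<in> S; Q \<in> S; Q \<in> \<pi> P\<rbrakk> \<Longrightarrow> \<pi> Q = \<pi> P"
    and centre: "(S = Pts \<and> (\<forall>P\<in>S. \<forall>Q\<in>S. parallel (\<pi> P) (\<pi> Q))) \<or>
      (\<exists>V\<in>Pts. S = Pts - {V} \<and> (\<forall>P\<in>S. V \<in> \<pi> P))"
begin

lemma S_Pts: "P \<in> S \<Longrightarrow> P \<in> Pts"
  using centre by auto

lemma join_not_pencil: "\<lbrakk>A \<in> S; B \<in> S; \<pi> A \<noteq> \<pi> B; P \<in> S\<rbrakk> \<Longrightarrow> join A B \<noteq> \<pi> P"
  using pencil_eq[of P] join_left[of A B] join_right[of A B] S_Pts by metis

lemma ex_off_pencil: "A \<in> S \<Longrightarrow> \<exists>B\<in>S. \<pi> B \<noteq> \<pi> A"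
proof -
  assume A: "A \<in> S"
  obtain B where "B \<in> Pts" "B \<notin> \<pi> A"
    using ex_point_off pencil_line A by blast
  \<comment> \<open>A centre would lie on \<open>\<pi> A\<close>, so a point off that line is not
    the centre.\<close>
  moreover from this have "B \<in> S"
    using centre A by auto
  ultimately show ?thesis
    using pencil_mem by blast
qed

text \<open>Two pairs of corresponding vertices of a Desargues configuration, with the side between
  them. Requiring different pencil lines makes the joins meaningful and lets three of the points
  determine the fourth.\<close>

definition moves :: "'p \<Rightarrow> 'p \<Rightarrow> 'p \<Rightarrow> 'p \<Rightarrow> bool" where
  "moves A A' B B' \<longleftrightarrow> A \<in> S \<and> A' \<in> S \<and> B \<in> S \<and> B' \<in> S \<and> \<pi> A' = \<pi> A \<and> \<pi> B' = \<pi> B \<and>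
     \<pi> A \<noteq> \<pi> B \<and> parallel (join A B) (join A' B')"

lemma moves_sym: "moves A A' B B' \<Longrightarrow> moves B B' A A'"
  unfolding moves_def by (auto simp: join_commute)

lemma moves_distinct:
  assumes "moves A A' B B'"
  shows "A \<noteq> B" "A' \<noteq> B'"
  using assms unfolding moves_def by auto

text \<open>Both candidates lie on the parallel to \<open>A B\<close> through \<open>A'\<close>.
  Were they distinct, this parallel would be the pencil line of \<open>B'\<close>, which misses
  \<open>A'\<close>.\<close>

lemma moves_unique:
  assumes "moves A A' B B'" "moves A A' B B''"
  shows "B' = B''"
proof (rule ccontr)
  assume "B' \<noteq> B''"
  have *: "A' \<in> S" "B' \<in> S" "B'' \<in> S" "\<pi> B' = \<pi> B''" "\<pi> A' \<noteq> \<pi> B'" "A' \<noteq> B'" "A' \<noteq> B''"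
    using assms unfolding moves_def by auto
  have "A \<in> Pts" "B \<in> Pts" "A \<noteq> B" "A' \<in> Pts" "B' \<in> Pts" "B'' \<in> Pts"
    using assms S_Pts unfolding moves_def by auto
  then have "join A' B' = join A' B''"
    using * assms parallel_meet_eq2[OF parallel_sym[of "join A B" "join A' B'"]
        parallel_sym[of "join A B" "join A' B''"], of A']
    by (simp add: moves_def join_line join_left)
  then have "join A' B' = \<pi> B'"
    using lines_eqI[of "join A' B'" "\<pi> B'" B' B''] join_line join_right pencil_line pencil_mem
      * S_Pts \<open>B' \<noteq> B''\<close> by metis
  then show False
    using join_not_pencil * by blast
qed

lemma moves_refl: "\<lbrakk>A \<in> S; B \<in> S; \<pi> A \<noteq> \<pi> B\<rbrakk> \<Longrightarrow> moves A A B B"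
  by (simp add: moves_def)

lemma moves_fixed_iff:
  assumes "moves A A' B B'"
  shows "A = A' \<longleftrightarrow> B = B'"
  using assms moves_unique moves_refl moves_sym unfolding moves_def by metis

text \<open>The image of \<open>B\<close> is the intersection of \<open>\<pi> B\<close> with the
  parallel to \<open>A B\<close> through \<open>A'\<close>.\<close>

lemma ex_moves:
  assumes "A \<in> S" "A' \<in> S" "\<pi> A' = \<pi> A" "B \<in> S" "\<pi> B \<noteq> \<pi> A"
  shows "\<exists>B'. moves A A' B B'"
proof -
  have pts: "A \<in> Pts" "B \<in> Pts" "A' \<in> Pts" "A \<noteq> B"
    using assms S_Pts by auto
  define k where "k = join A B"
  have k: "k \<in> L" "A \<in> k" "B \<in> k" "k \<noteq> \<pi> B" "k \<noteq> \<pi> A"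
    unfolding k_def using pts join_line join_left join_right join_not_pencil assms by metis+
  obtain m where m: "m \<in> L" "A' \<in> m" "parallel m k"
    using ex_parallel k(1) pts by blast
  have lines: "\<pi> A \<in> L" "\<pi> B \<in> L" and mem: "A \<in> \<pi> A" "B \<in> \<pi> B" "A' \<in> \<pi> A"
    using assms pencil_line pencil_mem by auto
  have "\<not> parallel m (\<pi> B)"
    using parallel_meet_eq2[OF parallel_sym[OF m(3)] _ k(3) mem(2)] m(1) k lines parallel_sym by blast
  then obtain B' where B': "B' \<in> m" "B' \<in> \<pi> B"
    by (auto simp: parallel_def)
  have "m \<noteq> \<pi> A"
    using parallel_meet_eq[OF m(3), of A] k mem by auto
  \<comment> \<open>If the intersection were the centre, it would lie on both \<open>m\<close> and
    \<open>\<pi> A\<close>, whose only common point is \<open>A'\<close>, and \<open>A'\<close> is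
    in \<open>S\<close>.\<close>
  have "B' \<in> S"
  proof (rule ccontr)
    assume "B' \<notin> S"
    moreover have "B' \<in> Pts"
      using B' m in_Pts by blast
    ultimately have "B' \<in> \<pi> A"
      using centre assms(1) by auto
    then have "B' = A'"
      using points_eqI[of m "\<pi> A" B' A'] m lines mem B' \<open>m \<noteq> \<pi> A\<close> by blast
    then show False
      using \<open>B' \<notin> S\<close> assms by simp
  qed
  then have "\<pi> B' = \<pi> B"
    using pencil_eq B' assms by blast
  then have "A' \<noteq> B'"
    using assms by metis
  then have "join A' B' = m"
    using join_eq m B' by blast
  then show ?thesis
    using assms \<open>B' \<in> S\<close> \<open>\<pi> B' = \<pi> B\<close> m(3) parallel_sym unfolding moves_def k_def by metis
qed

text \<open>Here Desargues' axiom enters, for the triangles \<open>A B C\<close> and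
  \<open>A' B' C'\<close>. It needs vertices that really move, so the case \<open>A = A'\<close>, in
  which all three are fixed, is treated apart.\<close>

lemma moves_trans:
  assumes AB: "moves A A' B B'" and BC: "moves B B' C C'" and AC: "\<pi> A \<noteq> \<pi> C"
  shows "moves A A' C C'"
proof (cases "A = A'")
  case True
  then have "B = B'" "C = C'"
    using AB BC moves_fixed_iff by metis+
  moreover have "A \<in> S" "C \<in> S"
    using AB BC by (auto simp: moves_def)
  ultimately show ?thesis
    using True moves_refl AC by metis
next
  case False
  then have ne: "A \<noteq> A'" "B \<noteq> B'" "C \<noteq> C'"
    using AB BC moves_fixed_iff by metis+
  have S: "A \<in> S" "B \<in> S" "C \<in> S" "A' \<in> S" "B' \<in> S" "C' \<in> S"
    and pi: "\<pi> A' = \<pi> A" "\<pi> B' = \<pi> B" "\<pi> C' = \<pi> C" "\<pi> A \<noteq> \<pi> B" "\<pi> B \<noteq> \<pi> C"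
    and par: "parallel (join A B) (join A' B')" "parallel (join B C) (join B' C')"
    using AB BC unfolding moves_def by auto
  have ne': "A \<noteq> B" "B \<noteq> C" "A \<noteq> C" "A' \<noteq> B'" "B' \<noteq> C'" "A' \<noteq> C'"
    using pi AC by metis+
  have pts: "A \<in> Pts" "B \<in> Pts" "C \<in> Pts" "A' \<in> Pts" "B' \<in> Pts" "C' \<in> Pts"
    using S S_Pts by auto
  have pl: "join X X' = \<pi> X" if "X \<in> S" "X' \<in> S" "\<pi> X' = \<pi> X" "X \<noteq> X'" for X X'
    using that join_eq pencil_line pencil_mem by metis
  have pls: "join A A' = \<pi> A" "join B B' = \<pi> B" "join C C' = \<pi> C"
    using pl S pi ne by auto
  \<comment> \<open>A common line would contain \<open>X\<close> and \<open>X'\<close>, hence be the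
    pencil line of \<open>X\<close>, which does not contain \<open>Y\<close>.\<close>
  have neq: "join X Y \<noteq> join X' Y'"
    if "X \<in> S" "X' \<in> S" "\<pi> X' = \<pi> X" "X \<noteq> X'" "Y \<in> S" "Y' \<in> S" "\<pi> Y' = \<pi> Y" "\<pi> X \<noteq> \<pi> Y" for X X' Y Y'
  proof
    assume eq: "join X Y = join X' Y'"
    have *: "X \<noteq> Y" "X' \<noteq> Y'" "X \<in> Pts" "X' \<in> Pts" "Y \<in> Pts" "Y' \<in> Pts"
      using that S_Pts by metis+
    have "join X Y = join X X'"
      using * that(4) eq join_left join_line join_eq by metis
    then show False
      using pl join_not_pencil that by metis
  qed
  have "distinct [join A A', join B B', join C C', join A C, join A' C']"
  proof -
    have "join A C \<noteq> \<pi> X" "join A' C' \<noteq> \<pi> X" if "X \<in> S" for X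
      using join_not_pencil that S pi AC by auto
    moreover have "join A C \<noteq> join A' C'"
      using neq S pi AC ne by auto
    ultimately show ?thesis
      unfolding pls using pi(4,5) AC S by (simp add: not_sym)
  qed
  moreover have "(parallel (join A A') (join B B') \<and> parallel (join B B') (join C C') \<and>
      parallel (join A A') (join C C')) \<or>
      (\<exists>V\<in>Pts. V \<in> join A A' \<and> V \<in> join B B' \<and> V \<in> join C C')"
    unfolding pls using centre S by blast
  moreover have "join A B \<noteq> join A' B'" "join B C \<noteq> join B' C'"
    using neq S pi ne by auto
  ultimately have "parallel (join A C) (join A' C')"
    using desargues[of A B C A' B' C'] pts ne ne' par by blast
  then show ?thesis
    unfolding moves_def using S pi AC by simp
qed

text \<open>A pencil with only two lines is a parallel class in the plane of order 2.\<close>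

lemma third_pencil_line:
  assumes "A \<in> S" "B \<in> S" "\<pi> A \<noteq> \<pi> B"
  shows "(\<exists>C\<in>S. \<pi> C \<noteq> \<pi> A \<and> \<pi> C \<noteq> \<pi> B) \<or> (\<pi> A \<inter> \<pi> B = {} \<and> Pts \<subseteq> \<pi> A \<union> \<pi> B)"
proof -
  have lines: "\<pi> A \<in> L" "\<pi> B \<in> L" and mem: "A \<in> \<pi> A" "B \<in> \<pi> B"
    using assms pencil_line pencil_mem by auto
  from centre show ?thesis
  proof (elim disjE conjE bexE)
    assume "S = Pts" and par: "\<forall>P\<in>S. \<forall>Q\<in>S. parallel (\<pi> P) (\<pi> Q)"
    show ?thesis
    proof (cases "Pts \<subseteq> \<pi> A \<union> \<pi> B")
      case True
      then show ?thesis
        using par assms by (auto simp: parallel_def)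
    next
      case False
      then show ?thesis
        using \<open>S = Pts\<close> pencil_mem by blast
    qed
  next
    fix V assume V: "V \<in> Pts" "S = Pts - {V}" "\<forall>P\<in>S. V \<in> \<pi> P"
    then have Vm: "V \<in> \<pi> A" "V \<in> \<pi> B" and VAB: "V \<noteq> A" "V \<noteq> B" "A \<noteq> B" "A \<in> Pts" "B \<in> Pts"
      using assms by auto
    define k where "k = join A B"
    have k: "k \<in> L" "A \<in> k" "B \<in> k" "k \<noteq> \<pi> A" "k \<noteq> \<pi> B"
      unfolding k_def using VAB join_line join_left join_right join_not_pencil assms by metis+
    \<comment> \<open>The third line is the parallel to \<open>A B\<close> through the centre. The
      parallel \<open>b\<close> to \<open>\<pi> B\<close> through \<open>A\<close> misses the
      centre, so it cuts \<open>c\<close> in a point of \<open>S\<close>.\<close>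
    obtain c where c: "c \<in> L" "V \<in> c" "parallel c k"
      using ex_parallel k(1) V by blast
    obtain b where b: "b \<in> L" "A \<in> b" "parallel b (\<pi> B)"
      using ex_parallel lines VAB by blast
    have cne: "c \<noteq> \<pi> A" "c \<noteq> \<pi> B"
      using parallel_meet_eq[OF c(3), of A] parallel_meet_eq[OF c(3), of B] k mem by auto
    have "\<not> parallel c b"
      using cne(2) parallel_meet_eq[OF parallel_trans[OF _ b(3) c(1) b(1) lines(2)] c(2) Vm(2)] by blast
    then obtain C where C: "C \<in> c" "C \<in> b"
      by (auto simp: parallel_def)
    have "A \<notin> \<pi> B"
      using pencil_eq assms by blast
    then have "V \<notin> b"
      using b Vm parallel_meet_eq[OF b(3), of V] by auto
    then have "C \<in> S" "C \<noteq> V"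
      using V C c in_Pts by auto
    moreover have "\<pi> C = c"
      using lines_eqI[of "\<pi> C" c C V] \<open>C \<in> S\<close> pencil_line pencil_mem V C c \<open>C \<noteq> V\<close> by blast
    ultimately show ?thesis
      using cne by auto
  qed
qed

text \<open>This makes the map to be built consistent along \<open>\<pi> A\<close>. If
  \<open>B\<close> and \<open>C\<close> lie on different pencil lines, pass from \<open>X\<close> to
  \<open>C\<close> through \<open>B\<close>; otherwise through a point \<open>D\<close> on a third
  pencil line. Without a third line the parallelism is checked directly.\<close>

lemma moves_exchange:
  assumes AB: "moves A A' B B'" and AC: "moves A A' C C'" and XB: "moves X X' B B'"
    and X: "\<pi> X = \<pi> A"
  shows "moves X X' C C'"
proof -
  have main: "moves X X' C C'" if AC: "moves A A' C C'" and BC: "\<pi> B \<noteq> \<pi> C" for C C'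
  proof -
    have "moves B B' C C'"
      using moves_trans[OF moves_sym[OF AB] AC BC] .
    moreover have "\<pi> X \<noteq> \<pi> C"
      using AC X by (auto simp: moves_def)
    ultimately show ?thesis
      using moves_trans XB by blast
  qed
  show ?thesis
  proof (cases "\<pi> B = \<pi> C")
    case True
    have S: "A \<in> S" "B \<in> S" "C \<in> S" "X \<in> S" "A' \<in> S" "C' \<in> S" "X' \<in> S" "\<pi> A \<noteq> \<pi> B"
      "\<pi> A' = \<pi> A" "\<pi> C' = \<pi> C" "\<pi> X' = \<pi> X"
      using AB AC XB by (auto simp: moves_def)
    then consider D where "D \<in> S" "\<pi> D \<noteq> \<pi> A" "\<pi> D \<noteq> \<pi> B"
      | "\<pi> A \<inter> \<pi> B = {}" "Pts \<subseteq> \<pi> A \<union> \<pi> B"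
      using third_pencil_line by metis
    then show ?thesis
    proof cases
      case 1
      then obtain D' where AD: "moves A A' D D'"
        using ex_moves S by metis
      then have XD: "moves X X' D D'"
        using main 1 by metis
      have "moves D D' C C'"
        using moves_trans[OF moves_sym[OF AD] AC] 1 True by simp
      then show ?thesis
        using moves_trans[OF XD] S True X by simp
    next
      case 2
      have fix_iff: "X = X' \<longleftrightarrow> C = C'"
        using moves_fixed_iff AB AC XB by metis
      have ne: "\<pi> X \<noteq> \<pi> C"
        using S True X by simp
      show ?thesis
      proof (cases "X = X'")
        case True
        then show ?thesis
          using fix_iff moves_refl S ne by metis
      next
        case False
        then have "C \<noteq> C'"
          using fix_iff by simp
        have "X \<noteq> C" "X' \<noteq> C'"
          using S ne by metis+
        have pts: "X \<in> Pts" "C \<in> Pts" "X' \<in> Pts" "C' \<in> Pts"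
          using S S_Pts by auto
        have mem: "X \<in> \<pi> A" "X' \<in> \<pi> A" "C \<in> \<pi> B" "C' \<in> \<pi> B"
          using S X True pencil_mem by metis+
        \<comment> \<open>Every point lies on \<open>\<pi> A\<close> or \<open>\<pi> B\<close>. A
          common point on the former would be both \<open>X\<close> and \<open>X'\<close>, on the
          latter both \<open>C\<close> and \<open>C'\<close>.\<close>
        have "join X C \<inter> join X' C' = {}"
        proof (rule ccontr)
          assume "join X C \<inter> join X' C' \<noteq> {}"
          then obtain W where W: "W \<in> join X C" "W \<in> join X' C'"
            by blast
          then have "W \<in> Pts"
            using in_Pts join_line pts \<open>X \<noteq> C\<close> by blast
          have neqs: "join X C \<noteq> \<pi> A" "join X C \<noteq> \<pi> B" "join X' C' \<noteq> \<pi> A" "join X' C' \<noteq> \<pi> B"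
            using join_not_pencil S ne by metis+
          have ls: "join X C \<in> L" "join X' C' \<in> L" "\<pi> A \<in> L" "\<pi> B \<in> L"
            using join_line pts \<open>X \<noteq> C\<close> \<open>X' \<noteq> C'\<close> pencil_line S by auto
          have ms: "X \<in> join X C" "C \<in> join X C" "X' \<in> join X' C'" "C' \<in> join X' C'"
            using join_left join_right pts \<open>X \<noteq> C\<close> \<open>X' \<noteq> C'\<close> by auto
          show False
          proof (cases "W \<in> \<pi> A")
            case True
            then have "W = X" "W = X'"
              using points_eqI W neqs ls ms mem by metis+
            then show False
              using \<open>X \<noteq> X'\<close> by simp
          next
            case False
            then have "W \<in> \<pi> B"
              using 2 \<open>W \<in> Pts\<close> by blast
            then have "W = C" "W = C'"
              using points_eqI W neqs ls ms mem by metis+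
            then show False
              using \<open>C \<noteq> C'\<close> by simp
          qed
        qed
        then show ?thesis
          unfolding moves_def using S ne by (simp add: parallel_def)
      qed
    qed
  qed (use main AC in blast)
qed

text \<open>The pair \<open>A\<close>, \<open>A'\<close> determines the images of the points off
  \<open>\<pi> A\<close>, and an auxiliary pair \<open>B\<close>, \<open>B'\<close> those of the
  points on it. \<open>moves_exchange\<close> reconciles the two clauses, and
  \<open>moves_trans\<close> compares two points off \<open>\<pi> A\<close>.\<close>

lemma ex_perspective_map:
  assumes A: "A \<in> S" "A' \<in> S" "A' \<in> \<pi> A"
  shows "\<exists>f. f A = A' \<and> (\<forall>X\<in>S. f X \<in> S \<and> \<pi> (f X) = \<pi> X) \<and>
    (\<forall>X\<in>S. \<forall>Y\<in>S. \<pi> X \<noteq> \<pi> Y \<longrightarrow> moves X (f X) Y (f Y))"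
proof -
  have A': "\<pi> A' = \<pi> A"
    using pencil_eq A by blast
  obtain B where B: "B \<in> S" "\<pi> B \<noteq> \<pi> A"
    using ex_off_pencil A by blast
  obtain B' where AB: "moves A A' B B'"
    using ex_moves A A' B by blast
  define f where "f X = (SOME X'. if \<pi> X = \<pi> A then moves B B' X X' else moves A A' X X')" for X
  have "if \<pi> X = \<pi> A then moves B B' X (f X) else moves A A' X (f X)" if "X \<in> S" for X
  proof -
    have "\<exists>X'. if \<pi> X = \<pi> A then moves B B' X X' else moves A A' X X'"
      using ex_moves that A A' AB B unfolding moves_def by metis
    then show ?thesis
      unfolding f_def by (rule someI_ex)
  qed
  then have on: "\<And>X. \<lbrakk>X \<in> S; \<pi> X = \<pi> A\<rbrakk> \<Longrightarrow> moves B B' X (f X)"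
    and off: "\<And>X. \<lbrakk>X \<in> S; \<pi> X \<noteq> \<pi> A\<rbrakk> \<Longrightarrow> moves A A' X (f X)"
    by metis+
  have fA: "f A = A'"
    using on moves_unique A AB moves_sym by blast
  have fS: "f X \<in> S \<and> \<pi> (f X) = \<pi> X" if "X \<in> S" for X
    using that on off unfolding moves_def by metis
  have mixed: "moves X (f X) Y (f Y)" if "X \<in> S" "Y \<in> S" "\<pi> X = \<pi> A" "\<pi> Y \<noteq> \<pi> A" for X Y
    using moves_exchange[OF AB off moves_sym[OF on]] that by blast
  have "moves X (f X) Y (f Y)" if "X \<in> S" "Y \<in> S" "\<pi> X \<noteq> \<pi> Y" for X Y
  proof -
    consider "\<pi> X = \<pi> A" | "\<pi> Y = \<pi> A" | "\<pi> X \<noteq> \<pi> A" "\<pi> Y \<noteq> \<pi> A"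
      by blast
    then show ?thesis
    proof cases
      case 1
      then show ?thesis using mixed that by metis
    next
      case 2
      then show ?thesis using mixed moves_sym that by metis
    next
      case 3
      then show ?thesis using moves_trans[OF moves_sym[OF off] off] that by blast
    qed
  qed
  then show ?thesis
    using fA fS by blast
qed

text \<open>What remains is the case of two points on one pencil line, where both joins are that
  line once the images are known to differ.\<close>

lemma perspective_map_join:
  assumes f: "\<forall>X\<in>S. f X \<in> S \<and> \<pi> (f X) = \<pi> X"
    and moves: "\<forall>X\<in>S. \<forall>Y\<in>S. \<pi> X \<noteq> \<pi> Y \<longrightarrow> moves X (f X) Y (f Y)"
    and XY: "X \<in> S" "Y \<in> S" "X \<noteq> Y"
  shows "f X \<noteq> f Y \<and> parallel (join X Y) (join (f X) (f Y))"
proof (cases "\<pi> X = \<pi> Y")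
  case True
  have "f X \<noteq> f Y"
  proof
    assume eq: "f X = f Y"
    obtain B where B: "B \<in> S" "\<pi> B \<noteq> \<pi> X"
      using ex_off_pencil XY by blast
    then have "moves B (f B) X (f X)" "moves B (f B) Y (f Y)"
      using moves XY True by metis+
    \<comment> \<open>Points and images may be exchanged in \<open>moves\<close>, so uniqueness
      applied backwards from the common image gives \<open>X = Y\<close>.\<close>
    then have "moves (f B) B (f X) X" "moves (f B) B (f X) Y"
      unfolding moves_def using eq parallel_sym by auto
    then show False
      using moves_unique XY by blast
  qed
  moreover have "join X Y = \<pi> X"
    using join_eq pencil_line pencil_mem XY True by metis
  moreover have "join (f X) (f Y) = \<pi> X"
    using join_eq pencil_line pencil_mem XY True f calculation(1) by metis
  ultimately show ?thesis
    by simp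
next
  case False
  then have "moves X (f X) Y (f Y)"
    using moves XY by blast
  then show ?thesis
    using moves_distinct by (auto simp: moves_def)
qed

end

section \<open>Existence of translations and central dilatations; commutativity of
  translations\<close>

context desargues_affine_plane
begin

lemma pencil_parallel:
  assumes d: "d \<in> L"
  shows "pencil Pts L Pts (parallel_through L d)"
proof
  show "parallel_through L d Q = parallel_through L d P"
    if "P \<in> Pts" "Q \<in> parallel_through L d P" for P Q
    using parallel_through_eq[OF d parallel_through_line[OF d that(1)] that(2)
        parallel_through_parallel[OF d that(1)]] .
  have "parallel (parallel_through L d P) (parallel_through L d Q)" if "P \<in> Pts" "Q \<in> Pts" for P Q
    using parallel_trans[OF parallel_through_parallel[OF d that(1)]
        parallel_sym[OF parallel_through_parallel[OF d that(2)]]]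
      parallel_through_line d that by blast
  then show "(Pts = Pts \<and> (\<forall>P\<in>Pts. \<forall>Q\<in>Pts.
      parallel (parallel_through L d P) (parallel_through L d Q))) \<or>
    (\<exists>V\<in>Pts. Pts = Pts - {V} \<and> (\<forall>P\<in>Pts. V \<in> parallel_through L d P))"
    by blast
qed (use parallel_through_line[OF d] parallel_through_mem[OF d] in auto)

lemma pencil_central:
  assumes V: "V \<in> Pts"
  shows "pencil Pts L (Pts - {V}) (join V)"
proof
  show "join V Q = join V P"
    if "P \<in> Pts - {V}" "Q \<in> Pts - {V}" "Q \<in> join V P" for P Q
    using that join_eq[of "join V P" V Q] join_line[OF V] join_left[OF V] by auto
  show "(Pts - {V} = Pts \<and> (\<forall>P\<in>Pts - {V}. \<forall>Q\<in>Pts - {V}. parallel (join V P) (join V Q))) \<or>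
    (\<exists>W\<in>Pts. Pts - {V} = Pts - {W} \<and> (\<forall>P\<in>Pts - {V}. W \<in> join V P))"
    using V join_left[OF V] by blast
qed (use join_line[OF V] join_right[OF V] in auto)

text \<open>The perspective map of the pencil of parallels to \<open>P Q\<close> is used. A fixed
  point \<open>X\<close> also fixes the points off its pencil line, by \<open>moves_unique\<close>
  against \<open>moves_refl\<close>, and two fixed points give the identity.\<close>

lemma ex_translation:
  assumes P: "P \<in> Pts" and Q: "Q \<in> Pts"
  shows "\<exists>f. translation f \<and> f P = Q"
proof (cases "P = Q")
  case True
  then show ?thesis
    using translation_id by blast
next
  case False
  define d where "d = join P Q"
  have d: "d \<in> L" "P \<in> d" "Q \<in> d"
    unfolding d_def using P Q False join_line join_left join_right by auto
  interpret pencil Pts L Pts "parallel_through L d"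
    by (rule pencil_parallel[OF d(1)])
  have "parallel_through L d P = d"
    using parallel_through_eq d by simp
  then obtain f where "f P = Q"
    and f: "\<forall>X\<in>Pts. f X \<in> Pts \<and> parallel_through L d (f X) = parallel_through L d X"
    and mv: "\<forall>X\<in>Pts. \<forall>Y\<in>Pts. parallel_through L d X \<noteq> parallel_through L d Y \<longrightarrow>
      moves X (f X) Y (f Y)"
    using ex_perspective_map[OF P Q] d by auto
  have dil: "dilatation f"
    unfolding dilatation_def using f perspective_map_join[OF f mv] by blast
  have "f Y = Y" if X: "X \<in> Pts" "f X = X" and Y: "Y \<in> Pts" for X Y
  proof -
    obtain W where W: "W \<in> Pts" "parallel_through L d W \<noteq> parallel_through L d X"
      using ex_off_pencil X by blast
    then have "f W = W"
      using moves_unique[OF moves_refl] mv X by metis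
    then show ?thesis
      using dilatation_eq[OF dil dilatation_id X(1) W(1)] W X Y by auto
  qed
  then show ?thesis
    using dil \<open>f P = Q\<close> unfolding translation_def by blast
qed

lemma ex_central_dilatation:
  assumes V: "V \<in> Pts" and l: "l \<in> L" "V \<in> l" "A \<in> l" "A' \<in> l" and ne: "A \<noteq> V" "A' \<noteq> V"
  shows "\<exists>f. dilatation f \<and> f V = V \<and> f A = A'"
proof -
  interpret pencil Pts L "Pts - {V}" "join V"
    by (rule pencil_central[OF V])
  have "A \<in> Pts - {V}" "A' \<in> Pts - {V}" "A' \<in> join V A"
    using l ne in_Pts join_eq[of l V A] by auto
  from ex_perspective_map[OF this] obtain f where fA: "f A = A'"
    and f: "\<forall>X\<in>Pts - {V}. f X \<in> Pts - {V} \<and> join V (f X) = join V X"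
    and mv: "\<forall>X\<in>Pts - {V}. \<forall>Y\<in>Pts - {V}. join V X \<noteq> join V Y \<longrightarrow> moves X (f X) Y (f Y)"
    by blast
  \<comment> \<open>The pencil excludes its centre, so the value there is set by hand; joins with
    \<open>V\<close> are pencil lines and are preserved.\<close>
  define g where "g = f(V := V)"
  have g: "g V = V" "\<And>X. X \<noteq> V \<Longrightarrow> g X = f X"
    by (auto simp: g_def)
  have gP: "\<And>X. \<lbrakk>X \<in> Pts; X \<noteq> V\<rbrakk> \<Longrightarrow> g X \<in> Pts \<and> g X \<noteq> V \<and> join V (g X) = join V X"
    using f g by auto
  have "g X \<noteq> g Y \<and> parallel (join X Y) (join (g X) (g Y))"
    if "X \<in> Pts" "Y \<in> Pts" "X \<noteq> Y" for X Y
  proof -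
    consider "X = V" "Y \<noteq> V" | "Y = V" "X \<noteq> V" | "X \<noteq> V" "Y \<noteq> V"
      using \<open>X \<noteq> Y\<close> by blast
    then show ?thesis
    proof cases
      case 1
      then show ?thesis
        using gP[of Y] g(1) that by auto
    next
      case 2
      then show ?thesis
        using gP[of X] g(1) that join_commute[of _ V] by auto
    next
      case 3
      then show ?thesis
        using perspective_map_join[OF f mv, of X Y] g that by auto
    qed
  qed
  then have "dilatation g"
    unfolding dilatation_def using gP g(1) V by metis
  then show ?thesis
    using g fA ne by metis
qed

text \<open>Translations along the same line commute because both commute with a transversal one.\<close>

lemma translations_commute:
  assumes f: "translation f" and g: "translation g" and X: "X \<in> Pts"
  shows "f (g X) = g (f X)"
proof (cases "f X = X")
  case True
  then show ?thesis
    using translation_fixed[OF f X] translation_Pts[OF g X] by simp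
next
  case False
  define l where "l = join X (f X)"
  have l: "l \<in> L" "X \<in> l" "f X \<in> l"
    unfolding l_def using X False translation_Pts[OF f] join_line join_left join_right by auto
  show ?thesis
  proof (cases "g X \<in> l")
    case False
    then show ?thesis
      using translations_commute_off[OF f g l _ X] by blast
  next
    case True
    obtain Q where Q: "Q \<in> Pts" "Q \<notin> l"
      using ex_point_off l by blast
    obtain h where h: "translation h" "h X = Q"
      using ex_translation X Q by blast
    \<comment> \<open>This puts \<open>h\<close> followed by \<open>g\<close> among the transversal
      translations, so \<open>f\<close> commutes with it as well as with \<open>h\<close>.\<close>
    have "g Q \<notin> l"
    proof -
      obtain a where a: "a \<in> L" "Q \<in> a" "parallel a l"
        using ex_parallel l(1) Q by blast
      then have "g Q \<in> a"
        using translation_trace[OF g l(1,2) True] by blast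
      then show ?thesis
        using a Q parallel_meet_eq[OF a(3)] by auto
    qed
    then have "f (g (h X)) = g (h (f X))"
      using translations_commute_off[OF f translation_comp[OF h(1) g] l _ X] h(2) by simp
    also have "h (f X) = f (h X)"
      using translations_commute_off[OF f h(1) l _ X] h(2) Q by simp
    finally show ?thesis
      using translation_eq[OF translation_comp[OF g f] translation_comp[OF f g] Q(1) _ X] h(2) by simp
  qed
qed

end

section \<open>The skew field of a line\<close>

locale desargues_line = desargues_affine_plane Pts L for Pts :: "'p set" and L +
  fixes Z I :: 'p
  assumes Z: "Z \<in> Pts" and I: "I \<in> Pts" and Z_ne_I: "Z \<noteq> I"
begin

abbreviation axis :: "'p set" where
  "axis \<equiv> join Z I"

lemma axis: "axis \<in> L" "Z \<in> axis" "I \<in> axis"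
  using Z I Z_ne_I join_line join_left join_right by auto

lemma axis_Pts: "A \<in> axis \<Longrightarrow> A \<in> Pts"
  using axis in_Pts by blast

subsection \<open>Points as vectors\<close>

text \<open>A choice is made because a translation is unique only on \<open>Pts\<close>; by
  \<open>translation_eq\<close> the choice does not affect values at points.\<close>

definition shift :: "'p \<Rightarrow> 'p \<Rightarrow> 'p" where
  "shift P = (SOME f. translation f \<and> f Z = P)"

lemma
  assumes "P \<in> Pts"
  shows shift_translation: "translation (shift P)"
    and shift_origin: "shift P Z = P"
proof -
  have "translation (shift P) \<and> shift P Z = P"
    unfolding shift_def using someI_ex[OF ex_translation[OF Z assms]] .
  then show "translation (shift P)" "shift P Z = P"
    by auto
qed

lemma shift_Pts: "\<lbrakk>P \<in> Pts; Q \<in> Pts\<rbrakk> \<Longrightarrow> shift P Q \<in> Pts"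
  using shift_translation translation_Pts by blast

lemma shift_eq: "\<lbrakk>translation f; f Z = P; Q \<in> Pts\<rbrakk> \<Longrightarrow> shift P Q = f Q"
  using translation_eq[of "shift P" f Z Q] shift_translation shift_origin Z translation_Pts by metis

text \<open>Associativity of vector addition: the composite of the translations by \<open>Q\<close>
  and \<open>P\<close> is a translation taking \<open>Z\<close> to \<open>shift P Q\<close>.\<close>

lemma shift_shift:
  assumes "P \<in> Pts" "Q \<in> Pts" "R \<in> Pts"
  shows "shift (shift P Q) R = shift P (shift Q R)"
  using shift_eq[OF translation_comp[OF shift_translation shift_translation], of Q P "shift P Q" R]
    shift_origin assms by simp

lemma shift_commute:
  assumes "P \<in> Pts" "Q \<in> Pts"
  shows "shift P Q = shift Q P"
  using translations_commute[OF shift_translation[OF assms(1)] shift_translation[OF assms(2)] Z]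
    shift_origin assms by simp

lemma shift_zero: "P \<in> Pts \<Longrightarrow> shift Z P = P"
  using shift_eq[OF translation_id] by simp

text \<open>One half of the parallelogram rule, from the trace of \<open>Q\<close>. The other half,
  \<open>shift_parallel\<close>, comes from the image of the line through \<open>Z\<close> and
  \<open>Q\<close>.\<close>

lemma shift_mem:
  assumes "k \<in> L" "Z \<in> k" "P \<in> k" "Q \<in> m" "m \<in> L" "parallel m k"
  shows "shift P Q \<in> m"
  using translation_trace[OF shift_translation assms(1,2) _ assms(5,6,4)] shift_origin assms in_Pts
  by metis

lemma shift_closed: "\<lbrakk>k \<in> L; Z \<in> k; P \<in> k; Q \<in> k\<rbrakk> \<Longrightarrow> shift P Q \<in> k"
  using shift_mem parallel_refl by blast

lemma shift_parallel:
  assumes "k \<in> L" "Z \<in> k" "Q \<in> k" "m \<in> L" "parallel m k" "P \<in> m"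
  shows "shift P Q \<in> m"
  using dilatation_mem[OF translation_dilatation[OF shift_translation] assms(1,4,5,2) _ assms(3)]
    shift_origin assms in_Pts by metis

lemma shift_cancel:
  "\<lbrakk>P \<in> Pts; Q \<in> Pts; R \<in> Pts; shift P Q = shift P R\<rbrakk> \<Longrightarrow> Q = R"
  using dilatation_inj[OF translation_dilatation[OF shift_translation]] by blast

text \<open>The negative of \<open>P\<close> is the image of \<open>Z\<close> under the translation
  taking \<open>P\<close> to \<open>Z\<close>.\<close>

lemma ex_shift_inverse:
  assumes "k \<in> L" "Z \<in> k" "P \<in> k"
  shows "\<exists>Q\<in>k. shift Q P = Z"
proof -
  have P: "P \<in> Pts"
    using assms in_Pts by blast
  then obtain f where f: "translation f" "f P = Z"
    using ex_translation Z by blast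
  then have "f Z \<in> k"
    using translation_trace[OF f(1) assms(1,3) _ assms(1) parallel_refl assms(2)] assms(2) by simp
  then show ?thesis
    using shift_eq[OF f(1) refl P] f(2) by metis
qed

subsection \<open>Scalars\<close>

text \<open>A dilatation fixing \<open>Z\<close> is injective and cannot take \<open>I\<close> to
  \<open>Z\<close>, so the scalar zero is given apart as a constant map.\<close>

definition scale :: "'p \<Rightarrow> 'p \<Rightarrow> 'p" where
  "scale A P = (if A = Z then Z else (SOME f. dilatation f \<and> f Z = Z \<and> f I = A) P)"

lemma scale_origin_left: "scale Z P = Z"
  by (simp add: scale_def)

lemma
  assumes "A \<in> axis" "A \<noteq> Z"
  shows scale_dilatation: "dilatation (scale A)"
    and scale_fixed: "scale A Z = Z"
    and scale_unit: "scale A I = A"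
proof -
  have eq: "scale A = (SOME f. dilatation f \<and> f Z = Z \<and> f I = A)"
    using assms by (auto simp: scale_def)
  have "dilatation (scale A) \<and> scale A Z = Z \<and> scale A I = A"
    unfolding eq
    using someI_ex[OF ex_central_dilatation[OF Z axis assms(1) Z_ne_I[symmetric] assms(2)]] .
  then show "dilatation (scale A)" "scale A Z = Z" "scale A I = A"
    by auto
qed

lemma scale_origin: "A \<in> axis \<Longrightarrow> scale A Z = Z"
  using scale_fixed scale_origin_left by metis

lemma scale_one: "A \<in> axis \<Longrightarrow> scale A I = A"
  using scale_unit scale_origin_left by metis

lemma scale_Pts: "\<lbrakk>A \<in> axis; P \<in> Pts\<rbrakk> \<Longrightarrow> scale A P \<in> Pts"
  using dilatation_Pts[OF scale_dilatation] scale_origin_left Z by metis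

lemma scale_eq:
  "\<lbrakk>dilatation f; f Z = Z; f I = A; A \<in> axis; A \<noteq> Z; P \<in> Pts\<rbrakk> \<Longrightarrow> scale A P = f P"
  using dilatation_eq[of "scale A" f Z I P] scale_dilatation scale_fixed scale_unit Z I Z_ne_I by metis

lemma scale_parallel:
  assumes "A \<in> axis" "k \<in> L" "m \<in> L" "parallel m k" "X \<in> k" "scale A X \<in> m" "Y \<in> k"
  shows "scale A Y \<in> m"
proof (cases "A = Z")
  case True
  then show ?thesis
    using assms(6) scale_origin_left by simp
next
  case False
  then show ?thesis
    using dilatation_mem[OF scale_dilatation] assms by blast
qed

lemma scale_closed: "\<lbrakk>A \<in> axis; k \<in> L; Z \<in> k; P \<in> k\<rbrakk> \<Longrightarrow> scale A P \<in> k"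
  using scale_parallel[of A k k Z P] scale_origin by simp

lemma scale_nonzero: "\<lbrakk>A \<in> axis; A \<noteq> Z; P \<in> Pts; P \<noteq> Z\<rbrakk> \<Longrightarrow> scale A P \<noteq> Z"
  using dilatation_inj[OF scale_dilatation, of A P Z] scale_fixed[of A] Z by metis

text \<open>For nonzero scalars the composite dilatation fixes \<open>Z\<close> and takes
  \<open>I\<close> to \<open>scale A B\<close>, and two values determine it.\<close>

lemma scale_scale:
  assumes "A \<in> axis" "B \<in> axis" "P \<in> Pts"
  shows "scale (scale A B) P = scale A (scale B P)"
proof (cases "A = Z \<or> B = Z")
  case True
  then show ?thesis
    using scale_origin_left scale_origin assms by auto
next
  case False
  then show ?thesis
    using scale_eq[OF dilatation_comp[OF scale_dilatation scale_dilatation], of A B "scale A B" P]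
      assms scale_fixed scale_unit scale_closed[OF _ axis(1,2)] scale_nonzero axis_Pts by simp
qed

lemma scale_unit_left: "P \<in> Pts \<Longrightarrow> scale I P = P"
  using scale_eq[OF dilatation_id] axis Z_ne_I by metis

text \<open>The dilatation with centre \<open>Z\<close> taking \<open>A\<close> to \<open>I\<close>
  sends \<open>I\<close> to a left inverse \<open>B\<close> of \<open>A\<close>. A left inverse
  \<open>C\<close> of \<open>B\<close> then equals \<open>A\<close>, as in any monoid, so
  \<open>B\<close> is two-sided.\<close>

lemma ex_scale_inverse:
  assumes A: "A \<in> axis" "A \<noteq> Z"
  shows "\<exists>B\<in>axis. B \<noteq> Z \<and> scale A B = I \<and> scale B A = I"
proof -
  have right: "\<exists>B\<in>axis. B \<noteq> Z \<and> scale B A = I" if A: "A \<in> axis" "A \<noteq> Z" for A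
  proof -
    obtain f where f: "dilatation f" "f Z = Z" "f A = I"
      using ex_central_dilatation[OF Z axis(1,2) A(1) axis(3) A(2)] Z_ne_I by blast
    have "f I \<in> axis"
      using dilatation_mem[OF f(1) axis(1) axis(1) parallel_refl axis(2) _ axis(3)] f(2) axis by simp
    moreover have "f I \<noteq> Z"
      using dilatation_inj[OF f(1) I Z] f(2) Z_ne_I by metis
    ultimately show ?thesis
      using scale_eq[OF f(1,2) refl] axis_Pts[OF A(1)] f(3) by metis
  qed
  obtain B where B: "B \<in> axis" "B \<noteq> Z" "scale B A = I"
    using right A by blast
  obtain C where C: "C \<in> axis" "C \<noteq> Z" "scale C B = I"
    using right B by blast
  have "A = scale (scale C B) A"
    using C scale_unit_left A axis_Pts by simp
  also have "\<dots> = C"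
    using scale_scale[OF C(1) B(1)] axis_Pts A B C scale_one by simp
  finally show ?thesis
    using B C by blast
qed

text \<open>Conjugating a translation by a dilatation fixing \<open>Z\<close> gives a translation.\<close>

lemma scale_shift:
  assumes A: "A \<in> axis" and P: "P \<in> Pts" and Q: "Q \<in> Pts"
  shows "scale A (shift P Q) = shift (scale A P) (scale A Q)"
proof (cases "A = Z")
  case True
  then show ?thesis
    using scale_origin_left shift_zero Z by simp
next
  case False
  then obtain B where B: "B \<in> axis" "B \<noteq> Z" "scale A B = I" "scale B A = I"
    using ex_scale_inverse A by blast
  have inv: "scale A (scale B X) = X" "scale B (scale A X) = X" if "X \<in> Pts" for X
    using scale_scale[OF A B(1) that] scale_scale[OF B(1) A that] B scale_unit_left that by auto
  define f where "f = (\<lambda>X. scale A (shift P (scale B X)))"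
  have dil: "dilatation f"
    unfolding f_def
    using dilatation_comp[OF scale_dilatation[OF A False]
        dilatation_comp[OF translation_dilatation[OF shift_translation[OF P]] scale_dilatation[OF B(1,2)]]] .
  have "f Y = Y" if X: "X \<in> Pts" "f X = X" and Y: "Y \<in> Pts" for X Y
  proof -
    have pts: "scale B X \<in> Pts" "scale B Y \<in> Pts" "shift P (scale B X) \<in> Pts"
      using scale_Pts shift_Pts B P X Y by auto
    have "shift P (scale B X) = scale B X"
      using inv(2)[OF pts(3)] X(2) by (simp add: f_def)
    then have "shift P (scale B Y) = scale B Y"
      using translation_fixed[OF shift_translation[OF P] pts(1) _ pts(2)] by blast
    then show ?thesis
      using inv(1)[OF Y] by (simp add: f_def)
  qed
  then have "translation f"
    using dil unfolding translation_def by blast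
  moreover have "f Z = scale A P"
    using scale_origin[OF B(1)] shift_origin[OF P] by (simp add: f_def)
  ultimately have "shift (scale A P) (scale A Q) = f (scale A Q)"
    using shift_eq scale_Pts A Q by blast
  then show ?thesis
    using inv(2)[OF Q] by (simp add: f_def)
qed

text \<open>Both sides are additive in \<open>P\<close>, preserve every line through \<open>Z\<close>, and agree at \<open>I\<close>; hence for
  \<open>R\<close> off the axis both send \<open>I + R\<close> to the intersection of two known lines.\<close>

lemma scale_shift_left:
  assumes A: "A \<in> axis" and B: "B \<in> axis" and P: "P \<in> Pts"
  shows "scale (shift A B) P = shift (scale A P) (scale B P)"
proof -
  define C where "C = shift A B"
  define f where "f = (\<lambda>X. shift (scale A X) (scale B X))"
  have C: "C \<in> axis" "C \<in> Pts"
    unfolding C_def using shift_closed axis A B axis_Pts by blast+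
  have fPts: "f X \<in> Pts" if "X \<in> Pts" for X
    unfolding f_def using that shift_Pts scale_Pts A B by blast
  have fI: "f I = C"
    unfolding f_def C_def using scale_one A B by simp
  have f_closed: "f X \<in> k" if "k \<in> L" "Z \<in> k" "X \<in> k" for k X
    unfolding f_def using that shift_closed scale_closed A B by blast
  have f_add: "f (shift X Y) = shift (f X) (f Y)" if "X \<in> Pts" "Y \<in> Pts" for X Y
  proof -
    define a b c d where "a = scale A X" and "b = scale A Y" and "c = scale B X" and "d = scale B Y"
    have pts: "a \<in> Pts" "b \<in> Pts" "c \<in> Pts" "d \<in> Pts"
      unfolding a_def b_def c_def d_def using that scale_Pts A B by auto
    have "f (shift X Y) = shift (shift a b) (shift c d)"
      unfolding f_def a_def b_def c_def d_def using scale_shift that A B by simp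
    also have "\<dots> = shift a (shift b (shift c d))"
      using shift_shift pts shift_Pts by simp
    also have "shift b (shift c d) = shift c (shift b d)"
      using shift_shift[of b c d] shift_shift[of c b d] shift_commute[of b c] pts by simp
    also have "shift a (shift c (shift b d)) = shift (shift a c) (shift b d)"
      using shift_shift pts shift_Pts by simp
    finally show ?thesis
      unfolding f_def a_def b_def c_def d_def .
  qed
  have off: "scale C R = f R" if R: "R \<in> Pts" "R \<notin> axis" for R
  proof -
    have "R \<noteq> Z"
      using R axis by auto
    define k where "k = join Z R"
    have k: "k \<in> L" "Z \<in> k" "R \<in> k"
      unfolding k_def using Z R \<open>R \<noteq> Z\<close> join_line join_left join_right by auto
    have "I \<notin> k"
      using lines_eqI[of k axis Z I] k axis R Z_ne_I by auto
    define S where "S = shift I R"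
    have S: "S \<in> Pts"
      unfolding S_def using shift_Pts I R by blast
    obtain m where m: "m \<in> L" "I \<in> m" "parallel m k"
      using ex_parallel k(1) I by blast
    have "S \<in> m"
      unfolding S_def using shift_parallel[OF k m(1,3,2)] .
    then have "S \<notin> k"
      using m \<open>I \<notin> k\<close> parallel_meet_eq[OF m(3)] by auto
    then have "S \<noteq> Z"
      using k by auto
    define n where "n = join Z S"
    have n: "n \<in> L" "Z \<in> n" "S \<in> n"
      unfolding n_def using Z S \<open>S \<noteq> Z\<close> join_line join_left join_right by auto
    obtain c where c: "c \<in> L" "C \<in> c" "parallel c k"
      using ex_parallel k(1) C by blast
    have "c \<noteq> n"
      using parallel_meet_eq[OF c(3), of Z] n k \<open>S \<notin> k\<close> by auto
    have sS: "scale C S = shift C (scale C R)" and fS: "f S = shift C (f R)"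
      unfolding S_def using scale_shift[OF C(1) I R(1)] scale_one C f_add I R fI by auto
    have "scale C S \<in> c" "f S \<in> c"
      unfolding sS fS
      using shift_parallel[OF k(1,2) _ c(1,3,2)] scale_closed[OF C(1) k] f_closed[OF k] by auto
    moreover have "scale C S \<in> n" "f S \<in> n"
      using scale_closed[OF C(1) n] f_closed[OF n] by auto
    ultimately have "scale C S = f S"
      using points_eqI \<open>c \<noteq> n\<close> c n by blast
    then show ?thesis
      unfolding sS fS using shift_cancel C scale_Pts fPts R by blast
  qed
  have "scale C P = f P"
  proof (cases "P \<in> axis")
    case True
    \<comment> \<open>For \<open>P\<close> on the axis, \<open>shift R P\<close> is off it. The case
      already settled, additivity and cancellation of \<open>R\<close> give the claim.\<close>
    obtain R where R: "R \<in> Pts" "R \<notin> axis"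
      using ex_point_off axis by blast
    obtain m where m: "m \<in> L" "R \<in> m" "parallel m axis"
      using ex_parallel axis(1) R by blast
    have "shift R P \<in> m"
      using shift_parallel[OF axis(1,2) True m(1,3,2)] .
    then have "shift R P \<notin> axis"
      using m R parallel_meet_eq[OF m(3)] by auto
    then have "scale C (shift R P) = f (shift R P)"
      using off shift_Pts R P by blast
    then have "shift (f R) (scale C P) = shift (f R) (f P)"
      using scale_shift[OF C(1) R(1) P] f_add[OF R(1) P] off[OF R] by simp
    then show ?thesis
      using shift_cancel fPts scale_Pts C R P by blast
  qed (use off P in blast)
  then show ?thesis
    by (simp add: C_def f_def)
qed

subsection \<open>The constructions of sum and product\<close>

text \<open>The construction follows the translation taking \<open>Z\<close> to \<open>A\<close>.
  Its first two lines are the parallel to the axis along which \<open>B1\<close> moves and the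
  parallel carrying the image of \<open>Z B1\<close>, so they meet in the image of
  \<open>B1\<close>; the last line carries the image of \<open>B B1\<close>.\<close>

lemma add_via_eq:
  assumes B1: "B1 \<in> Pts" "B1 \<notin> axis" and A: "A \<in> axis" and B: "B \<in> axis"
  shows "add_via L Z I B1 A B = shift A B"
proof -
  have ne: "B1 \<noteq> Z" "B1 \<noteq> B"
    using B1 B axis by auto
  have pts: "A \<in> Pts" "B \<in> Pts" "shift A B1 \<in> Pts"
    using A B B1 axis_Pts shift_Pts by auto
  define k where "k = join Z B1"
  have k: "k \<in> L" "Z \<in> k" "B1 \<in> k"
    unfolding k_def using Z B1 ne join_line join_left join_right by auto
  define d where "d = join B B1"
  have d: "d \<in> L" "B \<in> d" "B1 \<in> d"
    unfolding d_def using pts B1 ne join_line join_left join_right by auto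
  define a where "a = parallel_through L axis B1"
  have a: "a \<in> L" "B1 \<in> a" "parallel a axis"
    unfolding a_def using parallel_through_line parallel_through_mem parallel_through_parallel axis B1
    by auto
  define b where "b = parallel_through L k A"
  have b: "b \<in> L" "A \<in> b" "parallel b k"
    unfolding b_def using parallel_through_line parallel_through_mem parallel_through_parallel k pts
    by auto
  define c where "c = parallel_through L d (shift A B1)"
  have c: "c \<in> L" "shift A B1 \<in> c" "parallel c d"
    unfolding c_def using parallel_through_line parallel_through_mem parallel_through_parallel d pts
    by auto
  \<comment> \<open>Otherwise the axis would be parallel to \<open>k\<close>, hence equal to it by
    the common point \<open>Z\<close>, and would contain \<open>B1\<close>.\<close>
  have "a \<noteq> b"
    using parallel_meet_eq2[of axis a k Z] parallel_trans[OF parallel_sym[OF a(3)] _ axis(1) a(1) k(1)]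
      parallel_meet_eq[of axis k Z] b axis k B1 by auto
  moreover have "shift A B1 \<in> a"
    using shift_mem[OF axis(1,2) A a(2,1,3)] .
  moreover have "shift A B1 \<in> b"
    using shift_parallel[OF k b(1,3,2)] .
  ultimately have P1: "intersection_point a b = shift A B1"
    using intersection_point_eq a b by blast
  have "axis \<noteq> c"
    using parallel_meet_eq[of c d B] c d B B1 by auto
  moreover have "shift A B \<in> c"
    using dilatation_mem[OF translation_dilatation[OF shift_translation[OF pts(1)]] d(1) c(1,3) d(3) c(2) d(2)] .
  moreover have "shift A B \<in> axis"
    using shift_closed axis A B by blast
  ultimately have "intersection_point axis c = shift A B"
    using intersection_point_eq axis c by blast
  then show ?thesis
    using P1 unfolding add_via_def Let_def a_def b_def c_def d_def k_def by simp
qed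

text \<open>Here the lines follow \<open>scale A\<close>: \<open>a\<close> carries the image of
  \<open>I B1\<close>, the line \<open>Z B1\<close> is preserved, and \<open>c\<close> carries the
  image of \<open>B B1\<close>. For \<open>A = Z\<close> all these images shrink to \<open>Z\<close>
  and the same incidences hold.\<close>

lemma mult_via_eq:
  assumes B1: "B1 \<in> Pts" "B1 \<notin> axis" and A: "A \<in> axis" and B: "B \<in> axis"
  shows "mult_via L Z I B1 A B = scale A B"
proof -
  have ne: "B1 \<noteq> Z" "B1 \<noteq> B" "B1 \<noteq> I"
    using B1 B axis by auto
  have pts: "A \<in> Pts" "B \<in> Pts" "scale A B1 \<in> Pts"
    using A B B1 axis_Pts scale_Pts by auto
  define k where "k = join Z B1"
  have k: "k \<in> L" "Z \<in> k" "B1 \<in> k"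
    unfolding k_def using Z B1 ne join_line join_left join_right by auto
  define d where "d = join B B1"
  have d: "d \<in> L" "B \<in> d" "B1 \<in> d"
    unfolding d_def using pts B1 ne join_line join_left join_right by auto
  define e where "e = join I B1"
  have e: "e \<in> L" "I \<in> e" "B1 \<in> e"
    unfolding e_def using I B1 ne join_line join_left join_right by auto
  define a where "a = parallel_through L e A"
  have a: "a \<in> L" "A \<in> a" "parallel a e"
    unfolding a_def using parallel_through_line parallel_through_mem parallel_through_parallel e pts
    by auto
  define c where "c = parallel_through L d (scale A B1)"
  have c: "c \<in> L" "scale A B1 \<in> c" "parallel c d"
    unfolding c_def using parallel_through_line parallel_through_mem parallel_through_parallel d pts
    by auto
  have "e \<noteq> k"
    using lines_eqI[of e axis Z I] e k axis B1 Z_ne_I by auto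
  then have "a \<noteq> k"
    using parallel_meet_eq[OF a(3), of B1] k e by auto
  moreover have "scale A B1 \<in> a"
    using scale_parallel[OF A e(1) a(1,3) e(2) _ e(3)] scale_one[OF A] a(2) by simp
  moreover have "scale A B1 \<in> k"
    using scale_closed[OF A k] .
  ultimately have P1: "intersection_point a k = scale A B1"
    using intersection_point_eq a k by blast
  have "axis \<noteq> c"
    using parallel_meet_eq[of c d B] c d B B1 by auto
  moreover have "scale A B \<in> c"
    using scale_parallel[OF A d(1) c(1,3) d(3) c(2) d(2)] .
  moreover have "scale A B \<in> axis"
    using scale_closed axis A B by blast
  ultimately have "intersection_point axis c = scale A B"
    using intersection_point_eq axis c by blast
  then show ?thesis
    using P1 unfolding mult_via_def Let_def a_def c_def d_def k_def e_def by simp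
qed

text \<open>The definite description is legitimate because the value \<open>shift A B\<close> is
  free of \<open>B1\<close> and some auxiliary point exists off the axis.\<close>

lemma point_add_eq: "\<lbrakk>A \<in> axis; B \<in> axis\<rbrakk> \<Longrightarrow> point_add Pts L Z I A B = shift A B"
  unfolding point_add_def
  by (rule the_equality) (use ex_point_off[OF axis(1)] add_via_eq in \<open>metis | blast\<close>)+

lemma point_mult_eq: "\<lbrakk>A \<in> axis; B \<in> axis\<rbrakk> \<Longrightarrow> point_mult Pts L Z I A B = scale A B"
  unfolding point_mult_def
  by (rule the_equality) (use ex_point_off[OF axis(1)] mult_via_eq in \<open>metis | blast\<close>)+

text \<open>The two distributive laws are \<open>scale_shift\<close> and
  \<open>scale_shift_left\<close>. Nonzero points are units by \<open>ex_scale_inverse\<close>, and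
  \<open>Z\<close> is not, as scalars fix \<open>Z\<close> and \<open>Z\<close> differs from
  \<open>I\<close>.\<close>

lemma skew_field_line_ring: "skew_field (line_ring Pts L Z I)" (is "skew_field ?R")
proof -
  have add_closed: "shift A B \<in> axis" and mult_closed: "scale A B \<in> axis"
    if "A \<in> axis" "B \<in> axis" for A B
    using that shift_closed scale_closed axis by auto
  note simps = line_ring_def point_add_eq point_mult_eq add_closed mult_closed axis axis_Pts
  have "abelian_group ?R"
  proof (rule abelian_groupI)
    show "\<exists>B\<in>carrier ?R. B \<oplus>\<^bsub>?R\<^esub> A = \<zero>\<^bsub>?R\<^esub>" if "A \<in> carrier ?R" for A
    proof -
      have A: "A \<in> axis"
        using that by (simp add: line_ring_def)
      then obtain B where "B \<in> axis" "shift B A = Z"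
        using ex_shift_inverse axis by blast
      then show ?thesis
        using A by (auto simp: simps)
    qed
    show "A \<oplus>\<^bsub>?R\<^esub> B = B \<oplus>\<^bsub>?R\<^esub> A" if "A \<in> carrier ?R" "B \<in> carrier ?R" for A B
      using that shift_commute[of A B] by (simp add: simps)
  qed (auto simp: simps shift_shift shift_zero)
  moreover have "monoid ?R"
    by (rule monoidI) (auto simp: simps scale_scale scale_unit_left scale_one)
  ultimately interpret ring ?R
    by (rule ringI) (auto simp: simps scale_shift scale_shift_left)
  show ?thesis
  proof
    show "Units ?R = carrier ?R - {\<zero>\<^bsub>?R\<^esub>}"
    proof (intro equalityI subsetI)
      fix A assume "A \<in> Units ?R"
      then obtain B where B: "A \<in> axis" "B \<in> axis" "scale B A = I"
        unfolding Units_def by (auto simp: simps)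
      then have "A \<noteq> Z"
        using scale_origin Z_ne_I by metis
      then show "A \<in> carrier ?R - {\<zero>\<^bsub>?R\<^esub>}"
        using B by (simp add: simps)
    next
      fix A assume "A \<in> carrier ?R - {\<zero>\<^bsub>?R\<^esub>}"
      then have A: "A \<in> axis" "A \<noteq> Z"
        by (auto simp: line_ring_def)
      then obtain B where "B \<in> axis" "scale A B = I" "scale B A = I"
        using ex_scale_inverse by blast
      then show "A \<in> Units ?R"
        using A unfolding Units_def by (auto simp: simps)
    qed
  qed
qed

end

section \<open>The set of ratios is the whole line\<close>

lemma (in monoid) image_Units_mult_left:
  assumes "u \<in> Units G"
  shows "(\<lambda>x. u \<otimes> x) ` carrier G = carrier G"
proof
  show "carrier G \<subseteq> (\<lambda>x. u \<otimes> x) ` carrier G"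
  proof
    fix y assume y: "y \<in> carrier G"
    then have "y = u \<otimes> (inv u \<otimes> y)"
      using assms by (metis m_assoc Units_closed Units_inv_closed Units_r_inv l_one)
    then show "y \<in> (\<lambda>x. u \<otimes> x) ` carrier G"
      using y assms by blast
  qed
qed (use assms in auto)

lemma (in skew_field) sub_skew_field_carrier: "sub_skew_field (carrier R) R"
  by (intro sub_skew_field.intro sub_skew_field_axioms.intro skew_field_axioms carrier_is_subring)
    (simp add: skew_field_Units)

theorem theorem9:
  fixes Pts :: "'p set" and L :: "'p set set" and Z I B :: 'p
  assumes "desargues_affine_plane Pts L"
    and "Z \<in> Pts" and "I \<in> Pts" and "Z \<noteq> I"
    and "B \<in> line_through L Z I" and "B \<noteq> Z"
  shows "skew_field ((line_ring Pts L Z I) \<lparr>carrier := ratio_set Pts L Z I B\<rparr>) \<and>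
         sub_skew_field (ratio_set Pts L Z I B) (line_ring Pts L Z I)"
proof -
  interpret desargues_line Pts L Z I
    using assms(1-4) by (simp add: desargues_line_def desargues_line_axioms_def)
  interpret R: skew_field "line_ring Pts L Z I"
    by (rule skew_field_line_ring)
  have "B \<in> Units (line_ring Pts L Z I)"
    using assms(5,6) by (simp add: R.skew_field_Units) (simp add: line_ring_def)
  \<comment> \<open>Forming ratios is left multiplication by the inverse of \<open>B\<close>, itself
    a unit, so every point of the line is a ratio.\<close>
  then have "ratio_set Pts L Z I B = carrier (line_ring Pts L Z I)"
    using R.image_Units_mult_left[OF R.Units_inv_Units]
    by (simp add: ratio_set_def ratio_def setcompr_eq_image) (simp add: line_ring_def)
  then show ?thesis
    using R.sub_skew_field_carrier R.skew_field_axioms by simp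
qed

end
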